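(* Suppose that $P$ is a minimally non-$O(n^{d-1})$ $d$-dimensional 0-1 matrix of dimensions $k_1 \times k_2 \times \dots \times k_d$, and that $P$ is not a matrix that has all entries equal to $1$, two dimensions of length $2$, and all other dimensions of length $1$. Then the weight of $P$ is at most $$k_d-1+\prod_{i=1}^{d-1} k_i.$$
   Context: The weight of a 0-1 matrix is its number of $1$-entries. A $d$-dimensional 0-1 matrix $A$ contains a $d$-dimensional 0-1 matrix $P$ if $A$ has a submatrix (obtained by restricting each of the $d$ coordinates to a subset of its range) of the same dimensions as $P$ that can be turned into $P$ by changing any number of $1$-entries to $0$-entries; otherwise $A$ avoids $P$ (is $P$-free). $P'$ is properly contained in $P$ if $P$ contains $P'$ and $P'\neq P$. $\operatorname{ex}(n,P,d)$ is the maximum possible number of $1$-entries in a $P$-free $d$-dimensional 0-1 matrix of dimensions $n\times n\times\dots\times n$ (taken to be $0$ if no such matrix exists). A $d$-dimensional 0-1 matrix $P$ is minimally non-$O(n^{d-1})$ if $\operatorname{ex}(n,P,d)=\omega(n^{d-1})$ but $\operatorname{ex}(n,P',d)=O(n^{d-1})$ for every $d$-dimensional 0-1 matrix $P'$ properly contained in $P$. Asymptotics are for $n\to\infty$ with the forbidden matrix and $d$ fixed. *)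

theory Defs
  imports Complex_Main "HOL-Library.Landau_Symbols"
begin

text \<open>
  A multidimensional 0-1 matrix is given by the list of its side lengths and the set of the
  positions of its 1-entries; positions are lists of indices counted from 0. Since positions
  outside the matrix are excluded by \<open>is_matrix\<close>, equality of matrices is plain equality.
\<close>

datatype matrix01 = Matrix01 (dims: "nat list") (ones: "nat list set")

definition positions :: "nat list \<Rightarrow> nat list set" where
  "positions ks = {xs. list_all2 (<) xs ks}"

definition is_matrix :: "nat \<Rightarrow> matrix01 \<Rightarrow> bool" where
  "is_matrix d A \<longleftrightarrow>
     length (dims A) = d \<and> (\<forall>k \<in> set (dims A). 0 < k) \<and> ones A \<subseteq> positions (dims A)"

definition weight :: "matrix01 \<Rightarrow> nat" where
  "weight A = card (ones A)"

text \<open>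
  The \<open>i\<close>-th coordinate is restricted to the finite set \<open>Ss ! i\<close>, whose elements are
  renumbered from 0 in increasing order.
\<close>

definition submatrix :: "matrix01 \<Rightarrow> nat set list \<Rightarrow> matrix01" where
  "submatrix A Ss = Matrix01 (map card Ss)
     {xs \<in> positions (map card Ss). map2 (\<lambda>S x. sorted_list_of_set S ! x) Ss xs \<in> ones A}"

definition contains :: "matrix01 \<Rightarrow> matrix01 \<Rightarrow> bool" where
  "contains A P \<longleftrightarrow>
     (\<exists>Ss. list_all2 (\<lambda>S k. S \<subseteq> {..<k}) Ss (dims A) \<and>
           dims (submatrix A Ss) = dims P \<and> ones P \<subseteq> ones (submatrix A Ss))"

definition properly_contained :: "matrix01 \<Rightarrow> matrix01 \<Rightarrow> bool" where
  "properly_contained P' P \<longleftrightarrow> contains P P' \<and> P' \<noteq> P"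

definition free_cubes :: "nat \<Rightarrow> matrix01 \<Rightarrow> nat \<Rightarrow> matrix01 set" where
  "free_cubes n P d = {A. is_matrix d A \<and> dims A = replicate d n \<and> \<not> contains A P}"

definition ex_num :: "nat \<Rightarrow> matrix01 \<Rightarrow> nat \<Rightarrow> nat" where
  "ex_num n P d = (if free_cubes n P d = {} then 0 else Max (weight ` free_cubes n P d))"

definition minimally_non_O :: "nat \<Rightarrow> matrix01 \<Rightarrow> bool" where
  "minimally_non_O d P \<longleftrightarrow>
     is_matrix d P \<and>
     (\<lambda>n. real (ex_num n P d)) \<in> \<omega>(\<lambda>n. real n ^ (d - 1)) \<and>
     (\<forall>P'. is_matrix d P' \<and> properly_contained P' P \<longrightarrow>
           (\<lambda>n. real (ex_num n P' d)) \<in> O(\<lambda>n. real n ^ (d - 1)))"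

definition all_ones_two_by_two :: "nat \<Rightarrow> matrix01 \<Rightarrow> bool" where
  "all_ones_two_by_two d P \<longleftrightarrow>
     ones P = positions (dims P) \<and>
     (\<exists>i<d. \<exists>j<d. i \<noteq> j \<and> dims P ! i = 2 \<and> dims P ! j = 2 \<and>
        (\<forall>l<d. l \<noteq> i \<and> l \<noteq> j \<longrightarrow> dims P ! l = 1))"

end

theory Submission
  imports Defs
begin

text \<open>
  Call a 1-entry of \<open>P\<close> non-final if a later 1-entry agrees with it in all but the last coordinate.
  The final 1-entries are determined by their first \<open>d - 1\<close> coordinates, so if the weight of \<open>P\<close>
  exceeds the bound, two of the non-final ones agree in the last coordinate. This yields four
  1-entries \<open>(x, a)\<close>, \<open>(x, b)\<close>, \<open>(y, a)\<close>, \<open>(y, c)\<close> with \<open>x \<noteq> y\<close> and \<open>a < b \<le> c\<close>. These four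
  already force an extremal function of order at least \<open>n\<^sup>d\<^sup>-\<^sup>1 log n\<close>: the block recursion
  \<open>B \<mapsto> [[B, 0], [I, B]]\<close> gives, for \<open>n\<close> a power of 2, \<open>n \<times> n\<close> matrices of weight \<open>(n log n) / 2\<close> avoiding the
  planar version of the pattern (up to reversing the rows), and these are extended to \<open>d\<close> dimensions along a coordinate in
  which \<open>x\<close> and \<open>y\<close> differ. By minimality \<open>P\<close> has no other 1-entries, so its
  weight is 4, which exceeds the bound only for the excluded matrices.
\<close>

section \<open>Positions of a matrix and their number\<close>

lemma positions_Nil [simp]: "positions [] = {[]}"
  by (auto simp: positions_def)

lemma positions_Cons: "positions (k # ks) = (\<lambda>(x, xs). x # xs) ` ({..<k} \<times> positions ks)"
  by (auto simp: positions_def list_all2_Cons2 image_iff)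

lemma finite_positions [simp]: "finite (positions ks)"
  by (induction ks) (auto simp: positions_Cons)

lemma card_positions: "card (positions ks) = prod_list ks"
proof (induction ks)
  case (Cons k ks)
  have "inj_on (\<lambda>(x, xs). x # xs) ({..<k} \<times> positions ks)"
    by (auto simp: inj_on_def)
  then show ?case
    by (simp add: positions_Cons card_image card_cartesian_product Cons.IH)
qed simp

lemma in_positions_iff:
  "xs \<in> positions ks \<longleftrightarrow> length xs = length ks \<and> (\<forall>i<length ks. xs ! i < ks ! i)"
  by (auto simp: positions_def list_all2_conv_all_nth)

lemma in_positions_replicate_iff:
  "xs \<in> positions (replicate d n) \<longleftrightarrow> length xs = d \<and> set xs \<subseteq> {..<n}"
  by (auto simp: in_positions_iff subset_iff in_set_conv_nth)

lemma butlast_in_positions: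
  assumes "xs \<in> positions ks"
  shows "butlast xs \<in> positions (butlast ks)"
  using assms by (auto simp: in_positions_iff nth_butlast)

subsection \<open>Containment and the extremal function\<close>

text \<open>Enumerating each index set increasingly preserves strict order in every coordinate.
  Applied in both directions, this also preserves equality; the lower bounds use containment only in
  this form.\<close>

lemma contains_embedding:
  assumes "contains A P"
  obtains f where "f ` ones P \<subseteq> ones A"
    and "\<And>xs ys i. xs \<in> ones P \<Longrightarrow> ys \<in> ones P \<Longrightarrow> i < length (dims A) \<Longrightarrow>
           f xs ! i < f ys ! i \<longleftrightarrow> xs ! i < ys ! i"
proof -
  from assms obtain Ss where Ss: "list_all2 (\<lambda>S k. S \<subseteq> {..<k}) Ss (dims A)"
    and sub: "ones P \<subseteq> ones (submatrix A Ss)"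
    by (auto simp: contains_def)
  define f where "f = (\<lambda>xs. map2 (\<lambda>S x. sorted_list_of_set S ! x) Ss xs)"
  have len: "length Ss = length (dims A)"
    using Ss by (rule list_all2_lengthD)
  have bound: "length xs = length (dims A) \<and> (\<forall>i<length (dims A). xs ! i < card (Ss ! i))"
    if "xs \<in> ones P" for xs
    using that sub len by (auto simp: submatrix_def in_positions_iff)
  show ?thesis
  proof
    show "f ` ones P \<subseteq> ones A"
      using sub by (auto simp: submatrix_def f_def)
    fix xs ys i
    assume xs: "xs \<in> ones P" and ys: "ys \<in> ones P" and i: "i < length (dims A)"
    have nth: "f zs ! i = sorted_list_of_set (Ss ! i) ! (zs ! i)" if "zs \<in> ones P" for zs
      using bound[OF that] i len by (simp add: f_def)
    have "sorted_wrt (<) (sorted_list_of_set (Ss ! i))"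
      by (rule strict_sorted_list_of_set)
    then have "sorted_list_of_set (Ss ! i) ! u < sorted_list_of_set (Ss ! i) ! v"
      if "u < v" "v < card (Ss ! i)" for u v
      using that by (simp add: sorted_wrt_iff_nth_less)
    then have "sorted_list_of_set (Ss ! i) ! u < sorted_list_of_set (Ss ! i) ! v \<longleftrightarrow> u < v"
      if "u < card (Ss ! i)" "v < card (Ss ! i)" for u v
      using that by (metis less_asym linorder_neqE_nat)
    then show "f xs ! i < f ys ! i \<longleftrightarrow> xs ! i < ys ! i"
      using bound[OF xs] bound[OF ys] i by (simp add: nth xs ys)
  qed
qed

text \<open>Selecting every index makes the renumbering the identity, so deleting 1-entries alone is
  a containment. Minimality is applied to such matrices.\<close>

lemma contains_fewer_ones:
  assumes "is_matrix d P" and "W \<subseteq> ones P"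
  shows "contains P (Matrix01 (dims P) W)"
proof -
  let ?Ss = "map lessThan (dims P)"
  have card: "map card ?Ss = dims P"
    by (simp add: comp_def)
  have "xs \<in> ones (submatrix P ?Ss)" if "xs \<in> W" for xs
  proof -
    have *: "xs \<in> ones P" "xs \<in> positions (dims P)"
      using that assms by (auto simp: is_matrix_def)
    then have "map2 (\<lambda>S x. sorted_list_of_set S ! x) ?Ss xs = xs"
      by (intro nth_equalityI) (auto simp: in_positions_iff lessThan_atLeast0)
    with * show ?thesis
      by (simp add: submatrix_def comp_def)
  qed
  moreover have "list_all2 (\<lambda>S k. S \<subseteq> {..<k}) ?Ss (dims P)"
    by (simp add: list_all2_conv_all_nth)
  ultimately show ?thesis
    unfolding contains_def using card
    by (intro exI[of _ ?Ss]) (auto simp: submatrix_def comp_def)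
qed

lemma finite_free_cubes: "finite (free_cubes n P d)"
proof (rule finite_subset)
  show "free_cubes n P d \<subseteq> Matrix01 (replicate d n) ` Pow (positions (replicate d n))"
  proof
    fix A assume "A \<in> free_cubes n P d"
    then show "A \<in> Matrix01 (replicate d n) ` Pow (positions (replicate d n))"
      by (cases A) (auto simp: free_cubes_def is_matrix_def)
  qed
qed simp

lemma weight_le_ex_num:
  assumes "A \<in> free_cubes n P d"
  shows "weight A \<le> ex_num n P d"
proof -
  have "weight A \<le> Max (weight ` free_cubes n P d)"
    using assms by (intro Max_ge finite_imageI finite_free_cubes) simp
  then show ?thesis
    using assms by (auto simp: ex_num_def)
qed

subsection \<open>The planar construction\<close>

text \<open>These are the edges of the \<open>m\<close>-dimensional hypercube: in binary with
  \<open>m\<close> digits, \<open>p\<close> arises from \<open>t\<close> by changing a single 0 to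
  1.\<close>

primrec dyadic :: "nat \<Rightarrow> (nat \<times> nat) set" where
  "dyadic 0 = {}"
| "dyadic (Suc m) = dyadic m \<union> (\<lambda>(p, t). (p + 2 ^ m, t + 2 ^ m)) ` dyadic m
     \<union> (\<lambda>i. (i + 2 ^ m, i)) ` {..<2 ^ m}"

lemma dyadic_subset: "dyadic m \<subseteq> {..<2 ^ m} \<times> {..<2 ^ m}"
proof (induction m)
  case (Suc m)
  then show ?case by fastforce
qed simp

text \<open>The three blocks are disjoint, so the count doubles and gains \<open>2 ^ m\<close> at
  each stage. The factor 2 avoids the exponent \<open>m - 1\<close>.\<close>

lemma card_dyadic: "2 * card (dyadic m) = m * 2 ^ m"
proof (induction m)
  case (Suc m)
  let ?B = "dyadic m"
  let ?C = "(\<lambda>(p, t). (p + 2 ^ m, t + 2 ^ m)) ` ?B"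
  let ?D = "(\<lambda>i. (i + 2 ^ m, i)) ` {..<(2::nat) ^ m}"
  note sub = dyadic_subset[of m]
  have fin: "finite ?B"
    using sub by (rule finite_subset) simp
  have "?B \<inter> ?C = {}" "(?B \<union> ?C) \<inter> ?D = {}"
    using sub by auto
  then have "card (dyadic (Suc m)) = card ?B + card ?C + card ?D"
    using fin by (simp add: card_Un_disjoint)
  moreover have "card ?C = card ?B"
    by (intro card_image) (auto simp: inj_on_def)
  moreover have "card ?D = 2 ^ m"
    by (subst card_image) (auto simp: inj_on_def)
  ultimately show ?case
    using Suc.IH by (simp add: algebra_simps)
qed simp

text \<open>The halves containing row and column select the block. For \<open>p < 2 ^ m\<close>,
  membership in \<open>dyadic m\<close> forces \<open>t < 2 ^ m\<close>, which reflects the empty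
  upper right block.\<close>

lemma dyadic_Suc_iff:
  "(p, t) \<in> dyadic (Suc m) \<longleftrightarrow>
     (if p < 2 ^ m then (p, t) \<in> dyadic m
      else if t < 2 ^ m then p = t + 2 ^ m
      else (p - 2 ^ m, t - 2 ^ m) \<in> dyadic m)"
  using dyadic_subset[of m] by (force simp: image_iff)

text \<open>In binary, \<open>p\<close> and \<open>q\<close> add to \<open>a\<close> one bit each,
  and the bit added by \<open>q\<close> is the higher one. As \<open>a < c\<close>, the column
  \<open>c\<close> drops a lower bit of \<open>q\<close> and keeps that high bit, whereas
  \<open>b\<close> lacks it and agrees with \<open>c\<close> above it.\<close>

lemma dyadic_avoids:
  assumes "(p, a) \<in> dyadic m" "(p, b) \<in> dyadic m" "(q, a) \<in> dyadic m" "(q, c) \<in> dyadic m"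
    and "p < q" "a < b" "a < c"
  shows "b < c"
  using assms
proof (induction m arbitrary: p q a b c)
  case (Suc m)
  have small: "t < 2 ^ m" if "(p, t) \<in> dyadic m" for p t
    using that dyadic_subset[of m] by auto
  consider "q < 2 ^ m" | "p < 2 ^ m" "2 ^ m \<le> q" | "2 ^ m \<le> p"
    by linarith
  then show ?case
  proof cases
    case 1
    then show ?thesis
      using Suc.IH[of p a b q c] Suc.prems by (simp add: dyadic_Suc_iff del: dyadic.simps)
  next
    case 2
    \<comment> \<open>Row \<open>p\<close> vanishes in the right half. Row \<open>q\<close> has only
      the entry \<open>a\<close> in the left half, so \<open>c\<close> lies in the right half,
      beyond \<open>b\<close>.\<close>
    with Suc.prems have "a < 2 ^ m" "b < 2 ^ m"
      by (auto simp: dyadic_Suc_iff small simp del: dyadic.simps)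
    with 2 Suc.prems show ?thesis
      by (auto simp: dyadic_Suc_iff simp del: dyadic.simps split: if_splits)
  next
    case 3
    \<comment> \<open>Otherwise column \<open>a\<close> would meet the identity block in both rows,
      giving \<open>p = a + 2 ^ m = q\<close>.\<close>
    with Suc.prems have "2 ^ m \<le> a"
      by (auto simp: dyadic_Suc_iff simp del: dyadic.simps split: if_splits)
    then have "b - 2 ^ m < c - 2 ^ m"
      using 3 Suc.prems
      by (intro Suc.IH[of "p - 2 ^ m" "a - 2 ^ m" "b - 2 ^ m" "q - 2 ^ m" "c - 2 ^ m"])
        (simp_all add: dyadic_Suc_iff del: dyadic.simps)
    then show ?thesis by simp
  qed
qed simp

subsection \<open>Extension to higher dimensions\<close>

definition cylinder :: "nat \<Rightarrow> nat \<Rightarrow> nat \<Rightarrow> (nat \<times> nat) set \<Rightarrow> matrix01" where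
  "cylinder d n i B =
     Matrix01 (replicate d n) {z \<in> positions (replicate d n). (z ! i, z ! (d - 1)) \<in> B}"

text \<open>Each pair in \<open>B\<close> leaves the other \<open>d - 2\<close> coordinates free;
  \<open>g\<close> inserts the pair at index \<open>i\<close> and at the end.\<close>

lemma weight_cylinder_ge:
  assumes "i < d - 1" and B: "B \<subseteq> {..<n} \<times> {..<n}"
  shows "card B * n ^ (d - 2) \<le> weight (cylinder d n i B)"
proof -
  define g where "g = (\<lambda>((p, t), ys). take i ys @ p # drop i ys @ [t :: nat])"
  let ?X = "B \<times> positions (replicate (d - 2) n)"
  have len: "length ys = d - 2" if "ys \<in> positions (replicate (d - 2) n)" for ys
    using that by (simp add: in_positions_iff)
  have "inj_on g ?X"
  proof (rule inj_onI)
    fix u v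
    assume uv: "u \<in> ?X" "v \<in> ?X" "g u = g v"
    obtain p t ys p' t' ys' where eq: "u = ((p, t), ys)" "v = ((p', t'), ys')"
      by (metis surj_pair)
    with uv have "length (take i ys) = length (take i ys')"
      by (auto simp: len)
    with uv eq have "take i ys = take i ys'" "p = p'" "drop i ys = drop i ys'" "t = t'"
      by (auto simp: g_def)
    with eq show "u = v"
      by (metis append_take_drop_id)
  qed
  then have "card (g ` ?X) = card B * n ^ (d - 2)"
    by (simp add: card_image card_cartesian_product card_positions)
  moreover have "g ` ?X \<subseteq> ones (cylinder d n i B)"
  proof clarify
    fix p t ys
    assume pt: "(p, t) \<in> B" and ys: "ys \<in> positions (replicate (d - 2) n)"
    have "length ys = d - 2" "set ys \<subseteq> {..<n}"
      using ys by (simp_all add: in_positions_replicate_iff)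
    moreover have "g ((p, t), ys) ! i = p" "g ((p, t), ys) ! (d - 1) = t"
      using assms(1) len[OF ys] by (auto simp: g_def nth_append nth_Cons')
    ultimately show "g ((p, t), ys) \<in> ones (cylinder d n i B)"
      using pt B assms(1)
      by (auto simp: cylinder_def in_positions_replicate_iff g_def
          dest: in_set_takeD in_set_dropD)
  qed
  moreover have "finite (ones (cylinder d n i B))"
    by (simp add: cylinder_def)
  ultimately show ?thesis
    by (metis card_mono weight_def)
qed

text \<open>Projecting an embedded copy of the four 1-entries to coordinates \<open>i\<close> and
  \<open>d - 1\<close> gives four pairs in \<open>B\<close> with the same order relations,
  contradicting \<open>avoids\<close>.\<close>

lemma cylinder_free:
  assumes "n > 0" and "i < d - 1"
    and P: "us \<in> ones P" "us' \<in> ones P" "vs \<in> ones P" "vs' \<in> ones P"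
    and eq: "us ! i = us' ! i" "vs ! i = vs' ! i" "us ! (d - 1) = vs ! (d - 1)"
    and less: "us ! i \<noteq> vs ! i" "us ! (d - 1) < us' ! (d - 1)" "us' ! (d - 1) \<le> vs' ! (d - 1)"
    and avoids: "\<And>p q a b c. (p, a) \<in> B \<Longrightarrow> (p, b) \<in> B \<Longrightarrow> (q, a) \<in> B \<Longrightarrow> (q, c) \<in> B \<Longrightarrow>
       p < q \<longleftrightarrow> us ! i < vs ! i \<Longrightarrow> p \<noteq> q \<Longrightarrow> a < b \<Longrightarrow> b \<le> c \<Longrightarrow> False"
  shows "cylinder d n i B \<in> free_cubes n P d"
proof -
  have "\<not> contains (cylinder d n i B) P"
  proof
    assume "contains (cylinder d n i B) P"
    then obtain f where f: "f ` ones P \<subseteq> ones (cylinder d n i B)"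
      and order: "\<And>xs ys j. xs \<in> ones P \<Longrightarrow> ys \<in> ones P \<Longrightarrow> j < d \<Longrightarrow>
           f xs ! j < f ys ! j \<longleftrightarrow> xs ! j < ys ! j"
      by (rule contains_embedding) (simp add: cylinder_def)
    have same: "f xs ! j = f ys ! j \<longleftrightarrow> xs ! j = ys ! j"
      if "xs \<in> ones P" "ys \<in> ones P" "j < d" for xs ys j
      using order[OF that] order[of ys xs j] that by (metis less_irrefl linorder_neqE_nat)
    have B: "(f xs ! i, f xs ! (d - 1)) \<in> B" if "xs \<in> ones P" for xs
      using f that by (auto simp: cylinder_def)
    have d: "i < d" "d - 1 < d"
      using assms(2) by auto
    have "f us' ! i = f us ! i" "f vs' ! i = f vs ! i" "f us ! (d - 1) = f vs ! (d - 1)"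
      using same P d eq by metis+
    moreover have "f us ! i < f vs ! i \<longleftrightarrow> us ! i < vs ! i" "f us ! i \<noteq> f vs ! i"
        "f us ! (d - 1) < f us' ! (d - 1)" "f us' ! (d - 1) \<le> f vs' ! (d - 1)"
      using same[OF P(1,3) d(1)] order[OF P(1,3) d(1)] order[OF P(1,2) d(2)]
        order[OF P(4,2) d(2)] less by linarith+
    ultimately show False
      using avoids[of "f us ! i" "f us ! (d - 1)" "f us' ! (d - 1)" "f vs ! i" "f vs' ! (d - 1)"]
        B[OF P(1)] B[OF P(2)] B[OF P(3)] B[OF P(4)] by simp
  qed
  then show ?thesis
    using assms(1) by (auto simp: free_cubes_def cylinder_def is_matrix_def)
qed

text \<open>At \<open>n = 2 ^ m\<close> the cylinder has weight at least
  \<open>m * n ^ (d - 1) / 2\<close>. Powers of 2 suffice to refute an eventual upper bound.\<close>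

lemma not_bigo_of_four_ones:
  assumes "i < d - 1"
    and P: "us \<in> ones P" "us' \<in> ones P" "vs \<in> ones P" "vs' \<in> ones P"
    and eq: "us ! i = us' ! i" "vs ! i = vs' ! i" "us ! (d - 1) = vs ! (d - 1)"
    and less: "us ! i \<noteq> vs ! i" "us ! (d - 1) < us' ! (d - 1)" "us' ! (d - 1) \<le> vs' ! (d - 1)"
  shows "(\<lambda>n. real (ex_num n P d)) \<notin> O(\<lambda>n. real n ^ (d - 1))"
proof
  define flip :: "nat \<Rightarrow> nat \<times> nat \<Rightarrow> nat \<times> nat" where
    "flip m = (\<lambda>(p, t). (2 ^ m - 1 - p, t))" for m
  \<comment> \<open>By \<open>dyadic_avoids\<close>, of two rows sharing column \<open>a\<close> the
    lower-numbered one has the smaller further column. The pattern has \<open>b \<le> c\<close>, so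
    \<open>dyadic\<close> avoids it if \<open>vs\<close> comes first, and its row reversal if
    \<open>us\<close> does.\<close>
  define B where "B m = (if us ! i < vs ! i then flip m ` dyadic m else dyadic m)" for m
  have "inj_on (flip m) (dyadic m)" for m
    by (rule inj_on_subset[OF _ dyadic_subset]) (auto simp: inj_on_def flip_def)
  then have card_B: "card (B m) = card (dyadic m)" for m
    by (simp add: B_def card_image)
  have B_subset: "B m \<subseteq> {..<2 ^ m} \<times> {..<2 ^ m}" for m
    using dyadic_subset[of m] by (auto simp: B_def flip_def)
  have avoids: False
    if B: "(p, a) \<in> B m" "(p, b) \<in> B m" "(q, a) \<in> B m" "(q, c) \<in> B m"
      and *: "p < q \<longleftrightarrow> us ! i < vs ! i" "p \<noteq> q" "a < b" "b \<le> c" for m p q a b c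
  proof (cases "us ! i < vs ! i")
    case True
    have unflip: "(2 ^ m - 1 - r, t) \<in> dyadic m \<and> r < 2 ^ m" if "(r, t) \<in> B m" for r t
      using that True dyadic_subset[of m] by (auto simp: B_def flip_def)
    have "c < b"
    proof (rule dyadic_avoids)
      show "2 ^ m - 1 - q < 2 ^ m - 1 - p"
        using * True unflip[OF B(1)] unflip[OF B(3)] by auto
    qed (use B unflip * in auto)
    with * show False by simp
  next
    case False
    then have "c < b"
      using B * dyadic_avoids[of q a m c p b] by (auto simp: B_def)
    with * show False by simp
  qed
  have lower: "m * (2 ^ m) ^ (d - 1) \<le> 2 * ex_num (2 ^ m) P d" for m
  proof -
    have "(2::nat) ^ m * (2 ^ m) ^ (d - 2) = (2 ^ m) ^ (d - 1)"
      using assms(1) by (subst power_Suc[symmetric]) (simp add: Suc_diff_Suc numeral_2_eq_2)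
    then have "m * (2 ^ m) ^ (d - 1) = 2 * (card (B m) * (2 ^ m) ^ (d - 2))"
      using card_dyadic[of m] by (metis card_B mult.assoc)
    also have "\<dots> \<le> 2 * weight (cylinder d (2 ^ m) i (B m))"
      using weight_cylinder_ge[OF assms(1) B_subset] by simp
    also have "\<dots> \<le> 2 * ex_num (2 ^ m) P d"
      using cylinder_free[OF _ assms(1) P eq less avoids] by (simp add: weight_le_ex_num)
    finally show ?thesis .
  qed
  assume "(\<lambda>n. real (ex_num n P d)) \<in> O(\<lambda>n. real n ^ (d - 1))"
  then obtain C where "\<forall>\<^sub>F n in at_top. real (ex_num n P d) \<le> C * real n ^ (d - 1)"
    by (auto elim!: landau_o.bigE)
  then obtain N where C: "\<And>n. n \<ge> N \<Longrightarrow> real (ex_num n P d) \<le> C * real n ^ (d - 1)"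
    by (auto simp: eventually_at_top_linorder)
  \<comment> \<open>This makes \<open>m > 2 * C\<close> and \<open>2 ^ m > m > N\<close>.\<close>
  define m where "m = N + nat \<lceil>2 * C\<rceil> + 1"
  have "N \<le> 2 ^ m"
    using less_exp[of m] by (simp add: m_def)
  have "real m * (2 ^ m) ^ (d - 1) \<le> 2 * real (ex_num (2 ^ m) P d)"
    using of_nat_mono[OF lower[of m], where ?'a = real] by simp
  also have "\<dots> \<le> 2 * C * (2 ^ m) ^ (d - 1)"
    using C[OF \<open>N \<le> 2 ^ m\<close>] by simp
  finally have "real m \<le> 2 * C"
    by simp
  then show False
    unfolding m_def by linarith
qed

subsection \<open>Counting\<close>

lemma four_ones_of_large_weight:
  assumes "W \<subseteq> positions k" and "length k \<ge> 1"
    and "card W > last k - 1 + prod_list (butlast k)"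
  obtains us us' vs vs' where "us \<in> W" "us' \<in> W" "vs \<in> W" "vs' \<in> W"
    "butlast us = butlast us'" "butlast vs = butlast vs'" "butlast us \<noteq> butlast vs"
    "last us = last vs" "last us < last us'" "last us' \<le> last vs'"
proof -
  have W: "length w = length k" "last w < last k" "butlast w \<in> positions (butlast k)"
    if "w \<in> W" for w
  proof -
    have w: "w \<in> positions k"
      using assms(1) that by auto
    then show "butlast w \<in> positions (butlast k)"
      by (rule butlast_in_positions)
    from w show "length w = length k"
      by (simp add: in_positions_iff)
    with w assms(2) show "last w < last k"
      by (metis One_nat_def Suc_le_lessD diff_less in_positions_iff last_conv_nth length_0_conv
          less_numeral_extra(1) not_less_zero)
  qed
  have eqI: "u = v" if "u \<in> W" "v \<in> W" "butlast u = butlast v" "last u = last v" for u v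
    using that W(1) assms(2) by (metis append_butlast_last_id length_0_conv not_one_le_zero)
  have fin: "finite W"
    using assms(1) by (rule finite_subset) simp
  define L where "L = {w \<in> W. \<exists>w'\<in>W. butlast w' = butlast w \<and> last w < last w'}"
  have "inj_on butlast (W - L)"
    by (rule inj_onI) (auto simp: L_def intro: eqI dest: linorder_neqE_nat)
  then have "card (W - L) \<le> card (positions (butlast k))"
    by (rule card_inj_on_le) (auto simp: W)
  moreover have "card W = card L + card (W - L)"
    using fin by (metis (no_types, lifting) L_def add.commute card_Diff_subset card_mono
        finite_subset le_add_diff_inverse2 mem_Collect_eq subsetI)
  ultimately have "card {..<last k - 1} < card L"
    using assms(3) by (simp add: card_positions)
  \<comment> \<open>A non-final entry has a later one after it, so the top index is excluded; this
    saves the 1 in the bound.\<close>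
  moreover have "last ` L \<subseteq> {..<last k - 1}"
    using W(2) by (fastforce simp: L_def)
  ultimately have "\<not> inj_on last L"
    using card_inj_on_le[of last L "{..<last k - 1}"] by auto
  then obtain u v where "u \<in> L" "v \<in> L" and uv: "u \<noteq> v" "last u = last v"
    by (auto simp: inj_on_def)
  then obtain u' v' where
    "u \<in> W" "u' \<in> W" "butlast u' = butlast u" "last u < last u'"
    "v \<in> W" "v' \<in> W" "butlast v' = butlast v" "last v < last v'"
    by (auto simp: L_def)
  moreover from this uv have "butlast u \<noteq> butlast v"
    by (auto intro: eqI)
  \<comment> \<open>Exchanging the two pairs if necessary yields
    \<open>last us' \<le> last vs'\<close>.\<close>
  ultimately show ?thesis
    using that[of u u' v v'] that[of v v' u u'] uv by (metis linear)
qed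

section \<open>Products of side lengths and the conclusion\<close>

lemma prod_list_conv_prod_nth: "prod_list xs = (\<Prod>i<length xs. xs ! i)"
  by (induction xs) (simp_all add: prod.lessThan_Suc_shift del: prod.lessThan_Suc)

lemma prod_list_eq_1_iff: "prod_list ks = 1 \<longleftrightarrow> (\<forall>x\<in>set ks. x = 1)" for ks :: "nat list"
  by (induction ks) auto

lemma prod_list_eq_2:
  fixes ks :: "nat list"
  assumes "prod_list ks = 2"
  shows "\<exists>i<length ks. ks ! i = 2 \<and> (\<forall>j<length ks. j \<noteq> i \<longrightarrow> ks ! j = 1)"
  using assms
proof (induction ks)
  case (Cons k ks)
  then have "k dvd 2"
    by (metis dvd_triv_left prod_list.Cons)
  then have "k = 1 \<or> k = 2"
    using dvd_imp_le[of k 2] by (cases "k = 0") auto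
  then show ?case
  proof
    assume "k = 1"
    with Cons obtain i where "i < length ks" "ks ! i = 2" "\<forall>j<length ks. j \<noteq> i \<longrightarrow> ks ! j = 1"
      by auto
    with \<open>k = 1\<close> show ?thesis
      by (intro exI[of _ "Suc i"]) (auto simp: nth_Cons')
  next
    assume "k = 2"
    with Cons.prems have "\<forall>x\<in>set ks. x = 1"
      using prod_list_eq_1_iff[of ks] by simp
    with \<open>k = 2\<close> show ?thesis
      by (intro exI[of _ 0]) (auto simp: nth_Cons')
  qed
qed simp

theorem theorem3p21:
  fixes d :: nat and k :: "nat list" and P :: matrix01
  assumes "d \<ge> 1"
    and "dims P = k"
    and "minimally_non_O d P"
    and "\<not> all_ones_two_by_two d P"
  shows "weight P \<le> k ! (d - 1) - 1 + (\<Prod>i<d - 1. k ! i)"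
proof (rule ccontr)
  have P: "is_matrix d P"
    using assms(3) by (simp add: minimally_non_O_def)
  then have k: "length k = d" "ones P \<subseteq> positions k"
    using assms(2) by (auto simp: is_matrix_def)
  have last_k: "last k = k ! (d - 1)"
    using k(1) assms(1) by (subst last_conv_nth) auto
  have prod: "prod_list (butlast k) = (\<Prod>i<d - 1. k ! i)"
    using k(1) by (simp add: prod_list_conv_prod_nth nth_butlast)
  assume "\<not> ?thesis"
  then have large: "card (ones P) > last k - 1 + prod_list (butlast k)"
    by (simp add: weight_def last_k prod)
  obtain us us' vs vs' where W: "us \<in> ones P" "us' \<in> ones P" "vs \<in> ones P" "vs' \<in> ones P"
    and *: "butlast us = butlast us'" "butlast vs = butlast vs'" "butlast us \<noteq> butlast vs"
      "last us = last vs" "last us < last us'" "last us' \<le> last vs'"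
    by (rule four_ones_of_large_weight[OF k(2) _ large]) (use k(1) assms(1) in auto)
  have len: "length w = d" "last w = w ! (d - 1)" "last w < last k" if "w \<in> ones P" for w
  proof -
    have w: "w \<in> positions k"
      using k(2) that by auto
    then show "length w = d"
      using k(1) by (simp add: in_positions_iff)
    with assms(1) show "last w = w ! (d - 1)"
      by (subst last_conv_nth) auto
    with w assms(1) k(1) last_k show "last w < last k"
      by (simp add: in_positions_iff)
  qed
  obtain i where i: "i < d - 1" "us ! i \<noteq> vs ! i"
    using *(3) len W by (metis length_butlast nth_butlast nth_equalityI)
  \<comment> \<open>All side lengths are kept, so \<open>P'\<close> differs from \<open>P\<close> at
    most by deleted 1-entries.\<close>
  define P' where "P' = Matrix01 k {us, us', vs, vs'}"
  have "(\<lambda>n. real (ex_num n P' d)) \<notin> O(\<lambda>n. real n ^ (d - 1))"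
  proof (rule not_bigo_of_four_ones[OF i(1), of us P' us' vs vs'])
    show "us ! i = us' ! i" "vs ! i = vs' ! i"
      using * i W len by (metis length_butlast nth_butlast)+
  qed (use * i W len in \<open>simp_all add: P'_def\<close>)
  moreover have "is_matrix d P'"
    using P W assms(2) by (auto simp: is_matrix_def P'_def)
  moreover have "contains P P'"
    using contains_fewer_ones[OF P, of "{us, us', vs, vs'}"] W assms(2) by (simp add: P'_def)
  ultimately have "P' = P"
    using assms(3) by (auto simp: minimally_non_O_def properly_contained_def)
  then have ones: "ones P = {us, us', vs, vs'}"
    by (auto simp: P'_def)
  have "card (set [us, us', vs, vs']) \<le> length [us, us', vs, vs']"
    by (rule card_length)
  then have weight: "card (ones P) \<le> 4"
    by (simp add: ones)
  have "last k \<ge> 2"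
    using *(5) len(3)[OF W(2)] by linarith
  have "{butlast us, butlast vs} \<subseteq> positions (butlast k)"
    using W k(2) by (auto intro: butlast_in_positions)
  then have "card {butlast us, butlast vs} \<le> prod_list (butlast k)"
    unfolding card_positions[symmetric] by (rule card_mono[OF finite_positions])
  then have "prod_list (butlast k) \<ge> 2"
    using *(3) by simp
  \<comment> \<open>The bound is at least \<open>1 + 2 = 3\<close> and lies strictly below a weight
    of at most 4, so all these estimates are equalities.\<close>
  with \<open>last k \<ge> 2\<close> weight large
  have two: "last k = 2" "prod_list (butlast k) = 2" and four: "card (ones P) = 4"
    by linarith+
  have "k = butlast k @ [last k]"
    using k(1) assms(1) by (intro append_butlast_last_id[symmetric]) auto
  then have "prod_list k = 4"
    using two by (metis mult_2 mult.right_neutral numeral_Bit0 prod_list.Cons prod_list.Nil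
        prod_list.append)
  \<comment> \<open>Four 1-entries fill all four positions, so \<open>P\<close> is one of the
    excluded matrices.\<close>
  then have "ones P = positions k"
    using four by (intro card_subset_eq k(2)) (simp_all add: card_positions)
  moreover obtain j where "j < d - 1" "k ! j = 2" "\<forall>l<d - 1. l \<noteq> j \<longrightarrow> k ! l = 1"
    using prod_list_eq_2[OF two(2)] k(1) by (auto simp: nth_butlast)
  ultimately have "all_ones_two_by_two d P"
    unfolding all_ones_two_by_two_def
    using assms(1,2) two(1) last_k
    by (intro conjI exI[of _ j] exI[of _ "d - 1"]) auto
  with assms(4) show False ..
qed

end
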